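(* The $\mathbf{ab}$-index is multiplicative with respect to the Stanley product of quasi-graded posets: for two quasi-graded posets $P$ and $Q$, each having a minimal and a (different) maximal element, $$\Psi(P*Q)=\Psi(P)\cdot\Psi(Q).$$
   Context: A quasi-graded poset $(P,\rho,\bar\zeta)$ consists of a finite poset $P$, a function $\rho:P\to\mathbb N$ with $x<y\Rightarrow\rho(x)<\rho(y)$, and a complex-valued function $\bar\zeta$ in the incidence algebra of $P$ with $\bar\zeta(x,x)=1$ for all $x$. Write $\rho(x,y)=\rho(y)-\rho(x)$. If $P$ has minimal element $\hat0$ and maximal element $\hat1$ with $\hat0<\hat1$, normalize $\rho(\hat0)=0$; its $\mathbf{ab}$-index is the polynomial in non-commuting variables $\mathbf a,\mathbf b$ $$\Psi(P)=\sum_{c}\bar\zeta(x_0,x_1)\cdots\bar\zeta(x_{k-1},x_k)\cdot(\mathbf a-\mathbf b)^{\rho(x_0,x_1)-1}\,\mathbf b\,(\mathbf a-\mathbf b)^{\rho(x_1,x_2)-1}\,\mathbf b\cdots\mathbf b\,(\mathbf a-\mathbf b)^{\rho(x_{k-1},x_k)-1},$$ the sum over all chains $c=\{\hat0=x_0<x_1<\cdots<x_k=\hat1\}$, $k\ge1$. The Stanley product $P*Q$ of $(P,\rho_P,\bar\zeta_P)$ and $(Q,\rho_Q,\bar\zeta_Q)$ is the quasi-graded poset with underlying set the disjoint union $(P\setminus\{\hat1\})\cup(Q\setminus\{\hat0\})$; $x\le y$ iff (i) $x,y\in P\setminus\{\hat1\}$ and $x\le_Py$, or (ii) $x\in P\setminus\{\hat1\}$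 and $y\in Q\setminus\{\hat0\}$, or (iii) $x,y\in Q\setminus\{\hat0\}$ and $x\le_Qy$; $\rho(x)=\rho_P(x)$ for $x\in P\setminus\{\hat1\}$ and $\rho(x)=\rho_Q(x)+\rho_P(\hat0,\hat1)-1$ for $x\in Q\setminus\{\hat0\}$; $\bar\zeta(x,y)=\bar\zeta_P(x,y)$ in case (i), $\bar\zeta(x,y)=\bar\zeta_P(x,\hat1)\cdot\bar\zeta_Q(\hat0,y)$ in case (ii), $\bar\zeta(x,y)=\bar\zeta_Q(x,y)$ in case (iii). *)

theory Defs
  imports Complex_Main "HOL-Library.Poly_Mapping"
begin

text \<open>
  The ring of polynomials in the non-commuting variables a and b is realised as the monoid
  algebra over the complex numbers of the free monoid on two letters.
  \<open>Poly_Mapping\<close> multiplies by adding keys in an arbitrary (not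
  necessarily commutative) \<open>monoid_add\<close>, so the concatenation of words is written additively.
\<close>

datatype letter = Letter_a | Letter_b

datatype word = Word (letters: "letter list")

instantiation word :: monoid_add
begin

definition zero_word :: word
  where "0 = Word []"

definition plus_word :: "word \<Rightarrow> word \<Rightarrow> word"
  where "u + v = Word (letters u @ letters v)"

instance
  by standard (simp_all add: zero_word_def plus_word_def)

end

type_synonym ab_poly = "word \<Rightarrow>\<^sub>0 complex"

definition var_a :: ab_poly
  where "var_a = Poly_Mapping.single (Word [Letter_a]) 1"

definition var_b :: ab_poly
  where "var_b = Poly_Mapping.single (Word [Letter_b]) 1"

definition scalar :: "complex \<Rightarrow> ab_poly"
  where "scalar c = Poly_Mapping.single 0 c"

lemma single_Word_mult:
  "Poly_Mapping.single (Word u) (c::complex) * Poly_Mapping.single (Word v) d =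
     Poly_Mapping.single (Word (u @ v)) (c * d)"
  by (simp add: mult_single plus_word_def)

lemma var_a_b_noncommute: "var_a * var_b \<noteq> var_b * var_a"
  by (auto simp: var_a_def var_b_def single_Word_mult dest!: arg_cong[where f = Poly_Mapping.keys])


text \<open>
  An element of the incidence algebra is a function of the pairs \<open>x \<le> y\<close>. The weighted zeta
  function \<open>zbar\<close> is total for convenience; its values at other pairs are junk
  and are never used.
\<close>

record 'a qgposet =
  elems :: "'a set"
  ord :: "'a rel"
  rk :: "'a \<Rightarrow> nat"
  zbar :: "'a \<Rightarrow> 'a \<Rightarrow> complex"

definition quasi_graded :: "'a qgposet \<Rightarrow> bool"
  where "quasi_graded P \<longleftrightarrow>
    finite (elems P) \<and>
    partial_order_on (elems P) (ord P) \<and>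
    (\<forall>x y. (x, y) \<in> ord P \<and> x \<noteq> y \<longrightarrow> rk P x < rk P y) \<and>
    (\<forall>x\<in>elems P. zbar P x x = 1)"

definition is_bottom :: "'a qgposet \<Rightarrow> 'a \<Rightarrow> bool"
  where "is_bottom P z \<longleftrightarrow> z \<in> elems P \<and> (\<forall>x\<in>elems P. (z, x) \<in> ord P)"

definition is_top :: "'a qgposet \<Rightarrow> 'a \<Rightarrow> bool"
  where "is_top P u \<longleftrightarrow> u \<in> elems P \<and> (\<forall>x\<in>elems P. (x, u) \<in> ord P)"

definition bottom :: "'a qgposet \<Rightarrow> 'a"
  where "bottom P = (THE z. is_bottom P z)"

definition top_elem :: "'a qgposet \<Rightarrow> 'a"
  where "top_elem P = (THE u. is_top P u)"

text \<open>The last conjunct is the normalisation of the rank function at the minimal element.\<close>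

definition bounded_quasi_graded :: "'a qgposet \<Rightarrow> bool"
  where "bounded_quasi_graded P \<longleftrightarrow>
    quasi_graded P \<and> (\<exists>z. is_bottom P z) \<and> (\<exists>u. is_top P u) \<and> bottom P \<noteq> top_elem P \<and>
    rk P (bottom P) = 0"

text \<open>Only used for \<open>x \<le> y\<close>, where the subtraction of natural numbers does not truncate.\<close>

definition rk_diff :: "'a qgposet \<Rightarrow> 'a \<Rightarrow> 'a \<Rightarrow> nat"
  where "rk_diff P x y = rk P y - rk P x"

text \<open>
  A chain \<open>x\<^sub>0 < \<dots> < x\<^sub>k\<close> from the minimal to the maximal element, with \<open>k \<ge> 1\<close>, is
  given by the list of its elements in increasing order, which has length \<open>k + 1\<close>.
\<close>

definition max_min_chains :: "'a qgposet \<Rightarrow> 'a list set"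
  where "max_min_chains P = {xs. length xs \<ge> 2 \<and> set xs \<subseteq> elems P \<and>
    sorted_wrt (\<lambda>x y. (x, y) \<in> ord P \<and> x \<noteq> y) xs \<and>
    hd xs = bottom P \<and> last xs = top_elem P}"

definition chain_zbar :: "'a qgposet \<Rightarrow> 'a list \<Rightarrow> complex"
  where "chain_zbar P xs = (\<Prod>i<length xs - 1. zbar P (xs ! i) (xs ! Suc i))"

text \<open>\<open>prod_list\<close> keeps the order of the factors, so this is
  \<open>(a - b)\<^bsup>\<rho>(x\<^sub>0,x\<^sub>1) - 1\<^esup> \<cdot> b \<cdot> (a - b)\<^bsup>\<rho>(x\<^sub>1,x\<^sub>2) - 1\<^esup> \<cdot> b \<cdots> b \<cdot> (a - b)\<^bsup>\<rho>(x\<^sub>k\<^sub>-\<^sub>1,x\<^sub>k) - 1\<^esup>\<close>.\<close>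

definition chain_monomial :: "'a qgposet \<Rightarrow> 'a list \<Rightarrow> ab_poly"
  where "chain_monomial P xs =
    (var_a - var_b) ^ (rk_diff P (xs ! 0) (xs ! 1) - 1) *
    prod_list (map (\<lambda>i. var_b * (var_a - var_b) ^ (rk_diff P (xs ! i) (xs ! Suc i) - 1))
      [1..<length xs - 1])"

definition ab_index :: "'a qgposet \<Rightarrow> ab_poly"
  where "ab_index P = (\<Sum>xs\<in>max_min_chains P. scalar (chain_zbar P xs) * chain_monomial P xs)"

lemma finite_max_min_chains:
  assumes "quasi_graded P"
  shows "finite (max_min_chains P)"
proof -
  have "distinct xs" if "sorted_wrt (\<lambda>x y. (x, y) \<in> ord P \<and> x \<noteq> y) xs" for xs :: "'a list"
    using that by (induction xs) auto
  then have "max_min_chains P \<subseteq> {xs. set xs \<subseteq> elems P \<and> distinct xs}"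
    by (auto simp: max_min_chains_def)
  moreover have "finite {xs. set xs \<subseteq> elems P \<and> distinct xs}"
    using assms by (simp add: quasi_graded_def finite_subset_distinct)
  ultimately show ?thesis
    by (rule finite_subset)
qed

text \<open>
  The disjoint union is formed in the sum type. The value of \<open>zbar\<close> at a pair
  \<open>(Inr y, Inl x)\<close> is junk, as such a pair is never related.
\<close>

definition stanley_product :: "'a qgposet \<Rightarrow> 'b qgposet \<Rightarrow> ('a + 'b) qgposet"
  where "stanley_product P Q =
    (let P' = elems P - {top_elem P}; Q' = elems Q - {bottom Q} in
     \<lparr>elems = Inl ` P' \<union> Inr ` Q',
      ord = {(Inl x, Inl y) | x y. x \<in> P' \<and> y \<in> P' \<and> (x, y) \<in> ord P}
          \<union> {(Inl x, Inr y) | x y. x \<in> P' \<and> y \<in> Q'}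
          \<union> {(Inr x, Inr y) | x y. x \<in> Q' \<and> y \<in> Q' \<and> (x, y) \<in> ord Q},
      rk = (\<lambda>w. case w of
              Inl x \<Rightarrow> rk P x
            | Inr y \<Rightarrow> rk Q y + rk_diff P (bottom P) (top_elem P) - 1),
      zbar = (\<lambda>v w. case (v, w) of
              (Inl x, Inl y) \<Rightarrow> zbar P x y
            | (Inl x, Inr y) \<Rightarrow> zbar P x (top_elem P) * zbar Q (bottom Q) y
            | (Inr x, Inr y) \<Rightarrow> zbar Q x y
            | (Inr x, Inl y) \<Rightarrow> 0)\<rparr>)"

lemma bottom_eqI:
  assumes "quasi_graded P" "is_bottom P z"
  shows "bottom P = z"
  unfolding bottom_def
  using assms
  by (intro the_equality)
     (auto simp: quasi_graded_def is_bottom_def dest!: partial_order_onD(3) dest: antisymD)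

lemma top_elem_eqI:
  assumes "quasi_graded P" "is_top P u"
  shows "top_elem P = u"
  unfolding top_elem_def
  using assms
  by (intro the_equality)
     (auto simp: quasi_graded_def is_top_def dest!: partial_order_onD(3) dest: antisymD)

lemma bounded_quasi_gradedD:
  assumes "bounded_quasi_graded P"
  shows "is_bottom P (bottom P)" "is_top P (top_elem P)"
  using assms bottom_eqI top_elem_eqI unfolding bounded_quasi_graded_def by metis+

lemma stanley_product_bounded_quasi_graded:
  assumes P: "bounded_quasi_graded P" and Q: "bounded_quasi_graded Q"
  shows "bounded_quasi_graded (stanley_product P Q)"
    and "bottom (stanley_product P Q) = Inl (bottom P)"
    and "top_elem (stanley_product P Q) = Inr (top_elem Q)"
proof -
  let ?R = "stanley_product P Q"
  note bP = bounded_quasi_gradedD[OF P] and bQ = bounded_quasi_gradedD[OF Q]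
  have qP: "quasi_graded P" "bottom P \<noteq> top_elem P" "rk P (bottom P) = 0"
    and qQ: "quasi_graded Q" "bottom Q \<noteq> top_elem Q" "rk Q (bottom Q) = 0"
    using P Q by (auto simp: bounded_quasi_graded_def)
  have oP: "partial_order_on (elems P) (ord P)" and oQ: "partial_order_on (elems Q) (ord Q)"
    using qP qQ by (auto simp: quasi_graded_def)
  note dP = partial_order_onD[OF oP] and dQ = partial_order_onD[OF oQ]
  have rP: "rk P x < rk P (top_elem P)" if "x \<in> elems P - {top_elem P}" for x
    using that bP qP(1) by (auto simp: quasi_graded_def is_top_def)
  have rQ: "0 < rk Q y" if "y \<in> elems Q - {bottom Q}" for y
    using that bQ(1) qQ(1) by (fastforce simp: quasi_graded_def is_bottom_def)
  have rQ': "rk Q x < rk Q y" if "(x, y) \<in> ord Q" "x \<noteq> y" for x y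
    using that qQ(1) by (auto simp: quasi_graded_def)
  have "refl_on (elems ?R) (ord ?R)"
    using dP(1) dQ(1) by (auto simp: stanley_product_def Let_def refl_on_def)
  moreover have "trans (ord ?R)"
    using dP(2) dQ(2) by (auto simp: stanley_product_def Let_def intro!: transI dest: transD)
  moreover have "antisym (ord ?R)"
    using dP(3) dQ(3) by (auto simp: stanley_product_def Let_def intro!: antisymI dest: antisymD)
  moreover have "ord ?R \<subseteq> elems ?R \<times> elems ?R"
    by (auto simp: stanley_product_def Let_def)
  ultimately have o: "partial_order_on (elems ?R) (ord ?R)"
    by (simp add: partial_order_on_def preorder_on_def)
  have "rk ?R v < rk ?R w" if "(v, w) \<in> ord ?R" "v \<noteq> w" for v w
  proof -
    have "0 < rk P (top_elem P)"
      using rP[of "bottom P"] qP bP by (auto simp: is_bottom_def)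
    then show ?thesis
      using that rP rQ rQ' qP
      by (fastforce simp: stanley_product_def Let_def rk_diff_def quasi_graded_def
          intro: diff_less_mono add_less_mono1)
  qed
  then have q: "quasi_graded ?R"
    using qP(1) qQ(1) o by (auto simp: quasi_graded_def stanley_product_def Let_def)
  have b: "is_bottom ?R (Inl (bottom P))" and t: "is_top ?R (Inr (top_elem Q))"
    using bP bQ qP qQ by (auto simp: stanley_product_def Let_def is_bottom_def is_top_def)
  show b': "bottom ?R = Inl (bottom P)" and t': "top_elem ?R = Inr (top_elem Q)"
    using bottom_eqI[OF q b] top_elem_eqI[OF q t] by auto
  show "bounded_quasi_graded ?R"
    unfolding bounded_quasi_graded_def b' t'
    using q b t qP by (auto simp: stanley_product_def Let_def)
qed

end

(* A chain of the Stanley product is the concatenation of a chain ps in P without its top and a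
   chain qs in Q without its bottom; such pairs (ps, qs) are the same as pairs of chains of P and Q,
   namely ps with the top of P appended and qs with the bottom of Q prepended. The step from ps to qs
   has rank length r + s - 1, where r and s are the lengths of the last step in P and of the first
   step in Q. As (r + s - 1) - 1 = (r - 1) + (s - 1), the weight of this step is the product of the
   two weights without a letter b in between, so the weights of chains are multiplicative. *)
theory Submission
  imports Defs
begin

section \<open>Central scalars and the recursion for chain weights\<close>

lemma scalar_mult: "scalar (c * d) = scalar c * scalar d"
  by (simp add: scalar_def mult_single)

text \<open>The key of a scalar is the empty word, which is neutral on both sides, and complex
  coefficients commute. This lets values of \<open>zbar\<close> move past powers of
  \<open>var_a - var_b\<close> and past \<open>var_b\<close>.\<close>

lemma scalar_commute: "scalar c * p = p * scalar c"
proof (induction p rule: update_induct)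
  case const
  then show ?case by simp
next
  case (update f k v)
  \<comment> \<open>The key \<open>k\<close> is new, so \<open>f\<close> has coefficient 0 there and
    the update adds a monomial.\<close>
  then have "Poly_Mapping.update k v f = f + Poly_Mapping.single k v"
    by (intro poly_mapping_eqI) (auto simp: lookup_update lookup_add lookup_single in_keys_iff when_def)
  with update show ?case
    by (simp add: distrib_left distrib_right scalar_def mult_single mult.commute)
qed

text \<open>The letter \<open>b\<close> that separates consecutive steps is kept out, so that the
  weights of two steps can be merged into one.\<close>

definition step_weight :: "'a qgposet \<Rightarrow> 'a \<Rightarrow> 'a \<Rightarrow> ab_poly"
  where "step_weight P x y = scalar (zbar P x y) * (var_a - var_b) ^ (rk_diff P x y - 1)"

definition chain_weight :: "'a qgposet \<Rightarrow> 'a list \<Rightarrow> ab_poly"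
  where "chain_weight P xs = scalar (chain_zbar P xs) * chain_monomial P xs"

lemma chain_weight_pair: "chain_weight P [x, y] = step_weight P x y"
  by (simp add: chain_weight_def step_weight_def chain_zbar_def chain_monomial_def)

lemma chain_weight_Cons:
  assumes "length ys \<ge> 2"
  shows "chain_weight P (x # ys) = step_weight P x (hd ys) * var_b * chain_weight P ys"
proof -
  obtain y z zs where ys: "ys = y # z # zs"
    using assms by (cases ys rule: remdups_adj.cases) auto
  have "chain_zbar P (x # ys) = zbar P x y * chain_zbar P ys"
    by (simp add: ys chain_zbar_def prod.lessThan_Suc_shift del: prod.lessThan_Suc)
  \<comment> \<open>No \<open>b\<close> precedes step 0, hence the list of indices starts at 1.
    Behind \<open>x\<close>, the first step of \<open>ys\<close> becomes step 1 and acquires a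
    \<open>b\<close>; the later steps shift by one.\<close>
  moreover have "[1..<length (x # ys) - 1] = 1 # map Suc [1..<length ys - 1]"
    by (simp add: ys map_Suc_upt upt_conv_Cons del: upt_Suc)
  then have "chain_monomial P (x # ys) =
      (var_a - var_b) ^ (rk_diff P x y - 1) * (var_b * chain_monomial P ys)"
    by (simp add: ys chain_monomial_def comp_def mult.assoc)
  ultimately have "chain_weight P (x # ys) =
      scalar (zbar P x y) * (scalar (chain_zbar P ys) *
        ((var_a - var_b) ^ (rk_diff P x y - 1) * var_b)) * chain_monomial P ys"
    by (simp add: chain_weight_def scalar_mult mult.assoc)
  also have "\<dots> = scalar (zbar P x y) * (((var_a - var_b) ^ (rk_diff P x y - 1) * var_b) *
        scalar (chain_zbar P ys)) * chain_monomial P ys"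
    by (simp only: scalar_commute)
  also have "\<dots> = step_weight P x (hd ys) * var_b * chain_weight P ys"
    by (simp add: ys chain_weight_def step_weight_def mult.assoc)
  finally show ?thesis .
qed

section \<open>Weights in the Stanley product\<close>

context
  fixes P :: "'a qgposet" and Q :: "'b qgposet"
  assumes P: "bounded_quasi_graded P" and Q: "bounded_quasi_graded Q"
begin

lemma step_weight_stanley_Inl:
  "step_weight (stanley_product P Q) (Inl x) (Inl y) = step_weight P x y"
  by (simp add: step_weight_def stanley_product_def Let_def rk_diff_def)

lemma rk_less_top: "x \<in> elems P \<Longrightarrow> x \<noteq> top_elem P \<Longrightarrow> rk P x < rk P (top_elem P)"
  using P bounded_quasi_gradedD(2)[OF P]
  by (auto simp: bounded_quasi_graded_def quasi_graded_def is_top_def)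

lemma rk_pos: "y \<in> elems Q \<Longrightarrow> y \<noteq> bottom Q \<Longrightarrow> 0 < rk Q y"
  using Q bounded_quasi_gradedD(1)[OF Q]
  unfolding bounded_quasi_graded_def quasi_graded_def is_bottom_def by metis

text \<open>All ranks on the side of \<open>Q\<close> are shifted by the rank of the top of
  \<open>P\<close> minus 1. That rank is positive, so nothing truncates and the shift cancels in
  differences.\<close>

lemma step_weight_stanley_Inr:
  assumes "y \<in> elems Q" "y \<noteq> bottom Q"
  shows "step_weight (stanley_product P Q) (Inr x) (Inr y) = step_weight Q x y"
proof -
  have "rk P (bottom P) = 0" "bottom P \<noteq> top_elem P" "bottom P \<in> elems P"
    using P bounded_quasi_gradedD(1)[OF P] by (auto simp: bounded_quasi_graded_def is_bottom_def)
  then have "0 < rk P (top_elem P)" "rk P (bottom P) = 0"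
    using rk_less_top[of "bottom P"] by auto
  then have "rk Q y + rk P (top_elem P) - 1 - (rk Q x + rk P (top_elem P) - 1) = rk Q y - rk Q x"
    by simp
  then show ?thesis
    using \<open>rk P (bottom P) = 0\<close>
    by (simp add: step_weight_def stanley_product_def Let_def rk_diff_def)
qed

lemma step_weight_stanley_Inl_Inr:
  assumes "x \<in> elems P" "x \<noteq> top_elem P" "y \<in> elems Q" "y \<noteq> bottom Q"
  shows "step_weight (stanley_product P Q) (Inl x) (Inr y) =
    step_weight P x (top_elem P) * step_weight Q (bottom Q) y"
proof -
  let ?c = "var_a - var_b"
  have 0: "rk P (bottom P) = 0" "rk Q (bottom Q) = 0"
    using P Q by (auto simp: bounded_quasi_graded_def)
  \<comment> \<open>Both rank differences on the right are at least 1, so none of the subtractions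
    of 1 truncates.\<close>
  have "rk_diff (stanley_product P Q) (Inl x) (Inr y) - 1 =
      (rk_diff P x (top_elem P) - 1) + (rk_diff Q (bottom Q) y - 1)"
    using rk_less_top[OF assms(1,2)] rk_pos[OF assms(3,4)] 0
    by (simp add: stanley_product_def Let_def rk_diff_def)
  then have "step_weight (stanley_product P Q) (Inl x) (Inr y) =
      scalar (zbar P x (top_elem P)) * (scalar (zbar Q (bottom Q) y) *
        ?c ^ (rk_diff P x (top_elem P) - 1)) * ?c ^ (rk_diff Q (bottom Q) y - 1)"
    by (simp add: step_weight_def stanley_product_def Let_def scalar_mult power_add mult.assoc)
  also have "\<dots> = scalar (zbar P x (top_elem P)) * (?c ^ (rk_diff P x (top_elem P) - 1) *
        scalar (zbar Q (bottom Q) y)) * ?c ^ (rk_diff Q (bottom Q) y - 1)"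
    by (simp only: scalar_commute)
  finally show ?thesis
    by (simp add: step_weight_def mult.assoc)
qed

lemma chain_weight_stanley_Inr:
  assumes "set ys \<subseteq> elems Q - {bottom Q}" "length ys \<ge> 2"
  shows "chain_weight (stanley_product P Q) (map Inr ys) = chain_weight Q ys"
  using assms
proof (induction ys)
  case (Cons y ys)
  show ?case
  proof (cases "length ys \<ge> 2")
    case True
    then have "hd ys \<in> set ys" by (cases ys) auto
    with True Cons show ?thesis
      by (cases ys) (auto simp: chain_weight_Cons step_weight_stanley_Inr)
  next
    \<comment> \<open>The induction bottoms out at a chain with two entries, that is, a single
      step.\<close>
    case False
    with Cons.prems obtain z where "ys = [z]"
      by (cases ys rule: remdups_adj.cases) auto
    with Cons.prems show ?thesis
      by (simp add: chain_weight_pair step_weight_stanley_Inr)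
  qed
qed simp

text \<open>Induction peels off the steps inside \<open>P\<close>, which contribute the same left
  factors to both sides, until a single entry \<open>x\<close> is left before the crossing into
  \<open>Q\<close>.\<close>

lemma chain_weight_stanley:
  assumes "set xs \<subseteq> elems P - {top_elem P}" "xs \<noteq> []"
    and ys: "set ys \<subseteq> elems Q - {bottom Q}" "ys \<noteq> []"
  shows "chain_weight (stanley_product P Q) (map Inl xs @ map Inr ys) =
    chain_weight P (xs @ [top_elem P]) * chain_weight Q (bottom Q # ys)"
  using assms(1,2)
proof (induction xs rule: induct_list012)
  case (2 x)
  obtain y zs where "ys = y # zs" using ys(2) by (cases ys) auto
  then show ?case
  proof (cases "zs = []")
    \<comment> \<open>Here the crossing is the whole chain; otherwise a \<open>b\<close> and the
      weight of a chain inside \<open>Q\<close> follow it.\<close>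
    case True
    with \<open>ys = y # zs\<close> 2 ys show ?thesis
      by (simp add: chain_weight_pair step_weight_stanley_Inl_Inr)
  next
    case False
    then have "length ys \<ge> 2"
      using \<open>ys = y # zs\<close> by (cases zs) auto
    with \<open>ys = y # zs\<close> 2 ys show ?thesis
      using chain_weight_stanley_Inr[OF ys(1)]
      by (simp add: chain_weight_pair chain_weight_Cons step_weight_stanley_Inl_Inr mult.assoc)
  qed
next
  case (3 x x' xs)
  \<comment> \<open>Both remaining chains still contain a step, as \<open>chain_weight_Cons\<close>
    requires.\<close>
  have "length (map Inl (x' # xs) @ map Inr ys) \<ge> 2" "length ((x' # xs) @ [top_elem P]) \<ge> 2"
    using ys(2) by (cases ys; simp)+
  with 3 show ?case
    by (simp add: chain_weight_Cons step_weight_stanley_Inl mult.assoc)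
qed simp

end

section \<open>Chains of the Stanley product as pairs of chains\<close>

definition chains_below_top :: "'a qgposet \<Rightarrow> 'a list set"
  where "chains_below_top P = {xs. xs \<noteq> [] \<and> set xs \<subseteq> elems P - {top_elem P} \<and>
    sorted_wrt (\<lambda>x y. (x, y) \<in> ord P \<and> x \<noteq> y) xs \<and> hd xs = bottom P}"

definition chains_above_bottom :: "'a qgposet \<Rightarrow> 'a list set"
  where "chains_above_bottom P = {xs. xs \<noteq> [] \<and> set xs \<subseteq> elems P - {bottom P} \<and>
    sorted_wrt (\<lambda>x y. (x, y) \<in> ord P \<and> x \<noteq> y) xs \<and> last xs = top_elem P}"

text \<open>Strictness keeps the top out of all entries but the last; conversely, every other
  element lies below the top, so appending it always extends the chain.\<close>

lemma max_min_chains_conv_below_top: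
  assumes "bounded_quasi_graded P"
  shows "max_min_chains P = (\<lambda>xs. xs @ [top_elem P]) ` chains_below_top P"
proof (intro set_eqI iffI)
  fix xs assume *: "xs \<in> max_min_chains P"
  then obtain ys where "xs = ys @ [top_elem P]" "ys \<noteq> []"
    by (cases xs rule: rev_cases) (force simp: max_min_chains_def)+
  with * show "xs \<in> (\<lambda>xs. xs @ [top_elem P]) ` chains_below_top P"
    by (auto simp: max_min_chains_def chains_below_top_def sorted_wrt_append)
next
  fix xs assume "xs \<in> (\<lambda>xs. xs @ [top_elem P]) ` chains_below_top P"
  then show "xs \<in> max_min_chains P"
    using bounded_quasi_gradedD(2)[OF assms]
    by (auto simp: max_min_chains_def chains_below_top_def sorted_wrt_append is_top_def
        Suc_le_eq subset_iff)
qed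

lemma max_min_chains_conv_above_bottom:
  assumes "bounded_quasi_graded P"
  shows "max_min_chains P = (#) (bottom P) ` chains_above_bottom P"
proof (intro set_eqI iffI)
  fix xs assume *: "xs \<in> max_min_chains P"
  then obtain ys where "xs = bottom P # ys" "ys \<noteq> []"
    by (cases xs rule: remdups_adj.cases) (auto simp: max_min_chains_def)
  with * show "xs \<in> (#) (bottom P) ` chains_above_bottom P"
    by (auto simp: max_min_chains_def chains_above_bottom_def)
next
  fix xs assume "xs \<in> (#) (bottom P) ` chains_above_bottom P"
  then show "xs \<in> max_min_chains P"
    using bounded_quasi_gradedD(1)[OF assms]
    by (auto simp: max_min_chains_def chains_above_bottom_def is_bottom_def Suc_le_eq subset_iff)
qed

text \<open>Meant for chains of the Stanley product, where no element of \<open>Q\<close> lies below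
  an element of \<open>P\<close>.\<close>

lemma sum_list_split:
  assumes "sorted_wrt (\<lambda>v w. \<not> (\<exists>x y. v = Inr y \<and> w = Inl x)) zs"
  shows "\<exists>xs ys. zs = map Inl xs @ map Inr ys"
  using assms
proof (induction zs)
  case (Cons v zs)
  then obtain xs ys where zs: "zs = map Inl xs @ map Inr ys" by auto
  show ?case
  proof (cases v)
    case (Inl x)
    then have "v # zs = map Inl (x # xs) @ map Inr ys" using zs by simp
    then show ?thesis by blast
  next
    case (Inr y)
    \<comment> \<open>A nonempty \<open>xs\<close> would place an \<open>Inl\<close> after
      \<open>Inr y\<close>.\<close>
    with Cons.prems zs have "xs = []" by (cases xs) auto
    then have "v # zs = map Inl [] @ map Inr (y # ys)" using zs Inr by simp
    then show ?thesis by blast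
  qed
qed simp

lemma max_min_chains_stanley:
  assumes P: "bounded_quasi_graded P" and Q: "bounded_quasi_graded Q"
  shows "max_min_chains (stanley_product P Q) =
    (\<lambda>(xs, ys). map Inl xs @ map Inr ys) ` (chains_below_top P \<times> chains_above_bottom Q)"
    (is "?C = ?f ` ?S")
proof (intro set_eqI iffI)
  let ?R = "stanley_product P Q"
  note ends = stanley_product_bounded_quasi_graded(2,3)[OF P Q]
  fix zs
  {
    assume zs: "zs \<in> ?C"
    then have "sorted_wrt (\<lambda>v w. (v, w) \<in> ord ?R \<and> v \<noteq> w) zs"
      by (simp add: max_min_chains_def)
    then have "sorted_wrt (\<lambda>v w. \<not> (\<exists>x y. v = Inr y \<and> w = Inl x)) zs"
      by (rule sorted_wrt_mono_rel[rotated]) (auto simp: stanley_product_def Let_def)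
    then obtain xs ys where zs_eq: "zs = map Inl xs @ map Inr ys"
      using sum_list_split by blast
    have "hd zs = Inl (bottom P)" "last zs = Inr (top_elem Q)"
      using zs ends by (auto simp: max_min_chains_def)
    moreover have "zs \<noteq> []"
      using zs by (auto simp: max_min_chains_def)
    \<comment> \<open>If \<open>xs\<close> were empty, the chain would begin with an
      \<open>Inr\<close>; if \<open>ys\<close> were empty, it would end with an
      \<open>Inl\<close>.\<close>
    ultimately have ne: "xs \<noteq> []" "ys \<noteq> []"
      and ht: "hd xs = bottom P" "last ys = top_elem Q"
      by (cases "xs = []"; cases "ys = []"; simp add: zs_eq hd_map last_map)+
    have s: "set (map Inl xs @ map Inr ys) \<subseteq> elems ?R"
      "sorted_wrt (\<lambda>v w. (v, w) \<in> ord ?R \<and> v \<noteq> w) (map Inl xs @ map Inr ys)"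
      using zs zs_eq by (simp_all add: max_min_chains_def)
    have "set xs \<subseteq> elems P - {top_elem P}" "set ys \<subseteq> elems Q - {bottom Q}"
      using s(1) by (auto simp: stanley_product_def Let_def)
    moreover have "sorted_wrt (\<lambda>x y. (x, y) \<in> ord P \<and> x \<noteq> y) xs"
      "sorted_wrt (\<lambda>x y. (x, y) \<in> ord Q \<and> x \<noteq> y) ys"
      using s(2)
      by (auto simp: sorted_wrt_append sorted_wrt_map stanley_product_def Let_def
          elim!: sorted_wrt_mono_rel[rotated])
    ultimately show "zs \<in> ?f ` ?S"
      using ne ht zs_eq by (auto simp: chains_below_top_def chains_above_bottom_def)
  next
    assume "zs \<in> ?f ` ?S"
    then obtain xs ys where zs: "zs = map Inl xs @ map Inr ys"
      and xs: "xs \<in> chains_below_top P" and ys: "ys \<in> chains_above_bottom Q" by auto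
    have ne: "xs \<noteq> []" "ys \<noteq> []"
      and subs: "set xs \<subseteq> elems P - {top_elem P}" "set ys \<subseteq> elems Q - {bottom Q}"
      and sorted: "sorted_wrt (\<lambda>x y. (x, y) \<in> ord P \<and> x \<noteq> y) xs"
        "sorted_wrt (\<lambda>x y. (x, y) \<in> ord Q \<and> x \<noteq> y) ys"
      and ht: "hd xs = bottom P" "last ys = top_elem Q"
      using xs ys by (auto simp: chains_below_top_def chains_above_bottom_def)
    have "sorted_wrt (\<lambda>v w. (v, w) \<in> ord ?R \<and> v \<noteq> w) (map Inl xs)"
      unfolding sorted_wrt_map
      using sorted(1) subs(1)
      by (elim sorted_wrt_mono_rel[rotated]) (auto simp: stanley_product_def Let_def)
    moreover have "sorted_wrt (\<lambda>v w. (v, w) \<in> ord ?R \<and> v \<noteq> w) (map Inr ys)"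
      unfolding sorted_wrt_map
      using sorted(2) subs(2)
      by (elim sorted_wrt_mono_rel[rotated]) (auto simp: stanley_product_def Let_def)
    \<comment> \<open>Pairs across the two parts are related unconditionally, so any two chains can
      be joined.\<close>
    moreover have "(Inl x, Inr y) \<in> ord ?R" if "x \<in> set xs" "y \<in> set ys" for x y
      using that subs by (auto simp: stanley_product_def Let_def)
    ultimately have "sorted_wrt (\<lambda>v w. (v, w) \<in> ord ?R \<and> v \<noteq> w) zs"
      by (auto simp: zs sorted_wrt_append)
    moreover have "set zs \<subseteq> elems ?R"
      using subs by (auto simp: zs stanley_product_def Let_def)
    moreover have "length zs \<ge> 2"
      using ne by (cases xs; cases ys) (auto simp: zs)
    moreover have "hd zs = bottom ?R" "last zs = top_elem ?R"
      using ne ht ends by (simp_all add: zs hd_map last_map)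
    ultimately show "zs \<in> ?C"
      by (simp add: max_min_chains_def)
  }
qed

text \<open>Filtering a list by summand recovers both parts, which gives a left inverse.\<close>

lemma inj_map_Inl_append_map_Inr: "inj (\<lambda>(xs, ys). map Inl xs @ map Inr ys)"
proof (rule inj_on_inverseI)
  fix p :: "'a list \<times> 'b list" assume "p \<in> UNIV"
  show "(\<lambda>zs. (map projl (filter isl zs), map projr (filter (\<lambda>v. \<not> isl v) zs)))
    (case p of (xs, ys) \<Rightarrow> map Inl xs @ map Inr ys) = p"
    by (cases p) (simp add: filter_map comp_def)
qed

theorem lemma5p3:
  fixes P :: "'a qgposet" and Q :: "'b qgposet"
  assumes "bounded_quasi_graded P" and "bounded_quasi_graded Q"
  shows "ab_index (stanley_product P Q) = ab_index P * ab_index Q"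
proof -
  let ?A = "chains_below_top P" and ?B = "chains_above_bottom Q"
  let ?f = "\<lambda>(xs, ys). map Inl xs @ map Inr ys"
  have "inj_on ?f (?A \<times> ?B)"
    using inj_map_Inl_append_map_Inr by (rule inj_on_subset) simp
  then have "ab_index (stanley_product P Q) =
      (\<Sum>(xs, ys) \<in> ?A \<times> ?B. chain_weight (stanley_product P Q) (map Inl xs @ map Inr ys))"
    by (simp add: ab_index_def chain_weight_def max_min_chains_stanley[OF assms]
        sum.reindex case_prod_unfold)
  also have "\<dots> = (\<Sum>(xs, ys) \<in> ?A \<times> ?B.
      chain_weight P (xs @ [top_elem P]) * chain_weight Q (bottom Q # ys))"
    by (intro sum.cong)
      (auto simp: chains_below_top_def chains_above_bottom_def intro!: chain_weight_stanley assms)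
  also have "\<dots> = (\<Sum>xs\<in>?A. chain_weight P (xs @ [top_elem P])) *
      (\<Sum>ys\<in>?B. chain_weight Q (bottom Q # ys))"
    by (simp add: sum_product sum.cartesian_product)
  \<comment> \<open>Appending or prepending a fixed element is injective, so each factor reindexes
    to a sum over \<open>max_min_chains\<close>.\<close>
  also have "\<dots> = ab_index P * ab_index Q"
    unfolding ab_index_def max_min_chains_conv_below_top[OF assms(1)]
      max_min_chains_conv_above_bottom[OF assms(2)]
    by (simp add: sum.reindex inj_on_def chain_weight_def)
  finally show ?thesis .
qed

end
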